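(* Let $\mathcal{A}$ be a finite alphabet. For a closed set $X\subseteq\mathcal{A}^{\mathbb{N}}$, the following properties are equivalent. (i) $X$ is infinitely factorizable, i.e. $\mathcal{N}(X)=\{n\ge1:X=X^{[n]}\}$ is an infinite set. (ii) $X$ has an $n$-fold interleaving factorization for all $n\ge1$, i.e. $\mathcal{N}(X)=\{1,2,3,\dots\}$. (iii) For each $k\ge0$ there are nonempty subsets $\mathcal{A}_k\subseteq\mathcal{A}$ such that $X=\prod_{k=0}^{\infty}\mathcal{A}_k$ is a countable product of finite sets with the product topology.
   Context: $\mathbb{N}=\{0,1,2,\dots\}$, and $\mathcal{A}^{\mathbb{N}}$ carries the product topology, each copy of $\mathcal{A}$ being discrete. For $\mathbf{x}=a_0a_1a_2\cdots\in\mathcal{A}^{\mathbb{N}}$, $i\ge0$, $n\ge1$, the decimation is $\psi_{i,n}(\mathbf{x})=a_ia_{i+n}a_{i+2n}\cdots$, and $\psi_{i,n}(X)=\{\psi_{i,n}(\mathbf{x}):\mathbf{x}\in X\}$. The $n$-fold interleaving of sequences $\mathbf{x}_i=a_{i,0}a_{i,1}\cdots$ ($0\le i\le n-1$) is $b_0b_1b_2\cdots$ with $b_{i+jn}=a_{i,j}$ ($0\le i\le n-1$, $j\ge0$); the $n$-fold interleaving $(\circledast_n)_{i=0}^{n-1}X_i$ of sets is the set of all $n$-fold interleavings of $(\mathbf{x}_0,\dots,\mathbf{x}_{n-1})$ with $\mathbf{x}_i\in X_i$. $X$ has an $n$-fold interleaving factorization if $X=(\circledast_n)_{i=0}^{n-1}X_i$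 for some sets $X_i\subseteq\mathcal{A}^{\mathbb{N}}$. The $n$-fold interleaving closure of $X$ is $X^{[n]}=(\circledast_n)_{i=0}^{n-1}\psi_{i,n}(X)$.
   Formalization: The equivalence of (i) and (ii) with (iii) is stated only for nonempty X, since the empty set is closed and satisfies (i) and (ii) but is not a product of nonempty sets; (i) and (ii) are equivalent for all closed X. *)

theory Defs
  imports "HOL-Analysis.Analysis"
begin

text \<open>One-sided sequences over an alphabet \<open>A\<close> are functions \<open>nat \<Rightarrow> 'a\<close> with all values in
  \<open>A\<close>; the topological space of all of them is \<open>full_shift A\<close>.\<close>

definition full_shift :: "'a set \<Rightarrow> (nat \<Rightarrow> 'a) topology" where
  "full_shift A = product_topology (\<lambda>_. discrete_topology A) UNIV"

definition decimation :: "nat \<Rightarrow> nat \<Rightarrow> (nat \<Rightarrow> 'a) \<Rightarrow> nat \<Rightarrow> 'a" where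
  "decimation i n x = (\<lambda>j. x (i + j * n))"

text \<open>Only \<open>n \<ge> 1\<close> is meaningful below, and only the members with index \<open>i < n\<close> of the
  families \<open>x\<close> and \<open>Y\<close> matter.\<close>

definition interleave :: "nat \<Rightarrow> (nat \<Rightarrow> nat \<Rightarrow> 'a) \<Rightarrow> nat \<Rightarrow> 'a" where
  "interleave n x = (\<lambda>k. x (k mod n) (k div n))"

lemma interleave_apply: "i < n \<Longrightarrow> interleave n x (i + j * n) = x i j"
  by (simp add: interleave_def)

definition interleaving :: "nat \<Rightarrow> (nat \<Rightarrow> (nat \<Rightarrow> 'a) set) \<Rightarrow> (nat \<Rightarrow> 'a) set" where
  "interleaving n Y = {interleave n x | x. \<forall>i<n. x i \<in> Y i}"

definition has_interleaving_factorization ::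
    "'a set \<Rightarrow> nat \<Rightarrow> (nat \<Rightarrow> 'a) set \<Rightarrow> bool" where
  "has_interleaving_factorization A n X \<longleftrightarrow>
     (\<exists>Y. (\<forall>i<n. Y i \<subseteq> topspace (full_shift A)) \<and> X = interleaving n Y)"

definition interleaving_closure :: "nat \<Rightarrow> (nat \<Rightarrow> 'a) set \<Rightarrow> (nat \<Rightarrow> 'a) set" where
  "interleaving_closure n X = interleaving n (\<lambda>i. decimation i n ` X)"

definition factorization_set :: "(nat \<Rightarrow> 'a) set \<Rightarrow> nat set" where
  "factorization_set X = {n. n \<ge> 1 \<and> X = interleaving_closure n X}"

definition infinitely_factorizable :: "(nat \<Rightarrow> 'a) set \<Rightarrow> bool" where
  "infinitely_factorizable X \<longleftrightarrow> infinite (factorization_set X)"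

text \<open>The topological conjunct says that the subspace topology of \<open>X\<close> is the product topology of
  the discrete factors \<open>B k\<close>. As the factors are nonempty, the predicate is false for \<open>X = {}\<close>,
  although \<open>{}\<close> is closed and equal to all of its interleaving closures.\<close>

definition is_product_of_alphabets :: "'a set \<Rightarrow> (nat \<Rightarrow> 'a) set \<Rightarrow> bool" where
  "is_product_of_alphabets A X \<longleftrightarrow>
     (\<exists>B. (\<forall>k. B k \<noteq> {} \<and> B k \<subseteq> A) \<and> X = (\<Pi>\<^sub>E k\<in>UNIV. B k) \<and>
          subtopology (full_shift A) X = product_topology (\<lambda>k. discrete_topology (B k)) UNIV)"

end

(* Put X_k = {x k | x in X}.  If X = X^[n] then the first n coordinates of points of X may be
   prescribed independently: any z in the product of the X_k agrees below n with the interleaving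
   of the decimations of witnesses for z 0, ..., z (n - 1).  With n arbitrarily large, closedness
   puts z into X, so X is the product of the X_k; and a product is an n-fold interleaving for
   every n. *)

theory Submission
  imports Defs
begin

lemma topspace_full_shift: "topspace (full_shift A) = (\<Pi>\<^sub>E k\<in>UNIV. A)"
  by (simp add: full_shift_def)

lemma interleave_decimation:
  "interleave n (\<lambda>i. decimation i n (x i)) k = x (k mod n) k"
  by (simp add: interleave_def decimation_def)

text \<open>Decimating and interleaving cancel: position \<open>k\<close> receives coordinate
  \<open>k\<close> itself of the point chosen for the residue \<open>k mod n\<close>. Later
  arguments use the closure in this shift-free form.\<close>

lemma mem_interleaving_closure_iff:
  assumes "n \<ge> 1"
  shows "w \<in> interleaving_closure n X \<longleftrightarrow> (\<exists>x. (\<forall>i<n. x i \<in> X) \<and> w = (\<lambda>k. x (k mod n) k))"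
    (is "?L \<longleftrightarrow> ?R")
proof
  assume ?L
  then obtain u where u: "\<And>i. i < n \<Longrightarrow> \<exists>y\<in>X. u i = decimation i n y" and w: "w = interleave n u"
    by (auto simp: interleaving_closure_def interleaving_def image_iff)
  then obtain x where x: "\<And>i. i < n \<Longrightarrow> x i \<in> X \<and> u i = decimation i n (x i)"
    by metis
  have "w k = x (k mod n) k" for k
    using x[of "k mod n"] assms by (simp add: w interleave_def decimation_def)
  with x show ?R by blast
next
  assume ?R
  then obtain x where "\<forall>i<n. x i \<in> X" "w = (\<lambda>k. x (k mod n) k)" by blast
  then show ?L
    unfolding interleaving_closure_def interleaving_def
    by (auto intro!: exI[of _ "\<lambda>i. decimation i n (x i)"] simp: interleave_decimation)
qed

text \<open>Choose the same point for every residue.\<close>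

lemma subset_interleaving_closure: "n \<ge> 1 \<Longrightarrow> X \<subseteq> interleaving_closure n X"
  by (auto simp: mem_interleaving_closure_iff intro: exI[of _ "\<lambda>_. _"])

lemma decimation_interleave: "i < n \<Longrightarrow> decimation i n (interleave n x) = x i"
  by (simp add: decimation_def interleave_apply)

text \<open>Decimation recovers the factors of an interleaving, so the closure of \<open>X\<close>
  cannot exceed any interleaving equal to \<open>X\<close>. Conversely, the decimations of
  \<open>X\<close> serve as factors.\<close>

lemma has_interleaving_factorization_iff:
  assumes "n \<ge> 1" and "X \<subseteq> topspace (full_shift A)"
  shows "has_interleaving_factorization A n X \<longleftrightarrow> n \<in> factorization_set X"
proof
  assume "has_interleaving_factorization A n X"
  then obtain Y where X: "X = interleaving n Y"
    by (auto simp: has_interleaving_factorization_def)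
  \<comment> \<open>Equality can fail here: one empty factor makes \<open>X\<close> empty, while the
    other \<open>Y i\<close> may be nonempty.\<close>
  then have "decimation i n ` X \<subseteq> Y i" if "i < n" for i
    using that by (auto simp: interleaving_def decimation_interleave)
  then have "interleaving_closure n X \<subseteq> interleaving n Y"
    by (force simp: interleaving_closure_def interleaving_def)
  with X assms(1) show "n \<in> factorization_set X"
    using subset_interleaving_closure[of n X] by (auto simp: factorization_set_def)
next
  assume "n \<in> factorization_set X"
  moreover have "decimation i n ` X \<subseteq> topspace (full_shift A)" for i
    using assms(2) by (auto simp: decimation_def topspace_full_shift PiE_def)
  ultimately show "has_interleaving_factorization A n X"
    unfolding has_interleaving_factorization_def factorization_set_def interleaving_closure_def
    by (intro exI[of _ "\<lambda>i. decimation i n ` X"]) simp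
qed

text \<open>A basic open box around \<open>z\<close> restricts only finitely many coordinates; any
  strict bound on their indices serves as \<open>N\<close>.\<close>

lemma openin_full_shift_prefix:
  assumes "openin (full_shift A) U" and "z \<in> U"
  obtains N where "\<And>w. w \<in> topspace (full_shift A) \<Longrightarrow> (\<forall>k<N. w k = z k) \<Longrightarrow> w \<in> U"
proof -
  obtain V where fin: "finite {k. V k \<noteq> A}" and zV: "z \<in> Pi\<^sub>E UNIV V" and VU: "Pi\<^sub>E UNIV V \<subseteq> U"
    using assms unfolding full_shift_def openin_product_topology_alt by force
  obtain N where N: "{k. V k \<noteq> A} \<subseteq> {..<N}"
    using fin finite_nat_iff_bounded by blast
  have "w \<in> U" if "w \<in> topspace (full_shift A)" "\<forall>k<N. w k = z k" for w
  proof -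
    have "w k \<in> V k" for k
    proof (cases "V k = A")
      case True
      with that(1) show ?thesis by (auto simp: topspace_full_shift)
    next
      case False
      with N have "k < N" by blast
      with that(2) zV show ?thesis by (metis PiE_mem UNIV_I)
    qed
    with VU show ?thesis by (auto simp: PiE_def)
  qed
  with that show ?thesis by blast
qed

text \<open>Membership in a product is tested one coordinate at a time, so mixing coordinates of
  several members stays inside.\<close>

lemma PiE_factorization_set:
  assumes "n \<ge> 1"
  shows "n \<in> factorization_set (Pi\<^sub>E UNIV B)"
proof -
  have "interleaving_closure n (Pi\<^sub>E UNIV B) \<subseteq> Pi\<^sub>E UNIV B"
    using assms by (auto simp: mem_interleaving_closure_iff PiE_def Pi_def)
  with subset_interleaving_closure[OF assms] assms show ?thesis
    unfolding factorization_set_def by blast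
qed

lemma infinitely_factorizable_imp_product:
  assumes cl: "closedin (full_shift A) X" and inf: "infinitely_factorizable X"
  shows "X = (\<Pi>\<^sub>E k\<in>UNIV. (\<lambda>x. x k) ` X)"
proof
  show "X \<subseteq> (\<Pi>\<^sub>E k\<in>UNIV. (\<lambda>x. x k) ` X)" by auto
  show "(\<Pi>\<^sub>E k\<in>UNIV. (\<lambda>x. x k) ` X) \<subseteq> X"
  proof
    fix z assume "z \<in> (\<Pi>\<^sub>E k\<in>UNIV. (\<lambda>x. x k) ` X)"
    then have "\<forall>k. \<exists>x\<in>X. z k = x k" by (auto simp: PiE_def Pi_def)
    then obtain x where x: "\<And>k. x k \<in> X" "\<And>k. z k = x k k" by metis
    have sub: "X \<subseteq> topspace (full_shift A)" by (rule closedin_subset[OF cl])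
    then have z: "z \<in> topspace (full_shift A)"
      using x by (fastforce simp: topspace_full_shift)
    show "z \<in> X"
    proof (rule ccontr)
      assume "z \<notin> X"
      \<comment> \<open>The complement of \<open>X\<close> is open, so some prefix of
        \<open>z\<close> already forces a sequence out of \<open>X\<close>.\<close>
      with z have "z \<in> topspace (full_shift A) - X" by simp
      moreover have "openin (full_shift A) (topspace (full_shift A) - X)"
        using cl by blast
      ultimately obtain N where N: "\<And>w. w \<in> topspace (full_shift A) \<Longrightarrow> \<forall>k<N. w k = z k \<Longrightarrow>
          w \<in> topspace (full_shift A) - X"
        by (metis openin_full_shift_prefix)
      obtain n where n: "n \<in> factorization_set X" "n > N"
        using inf unfolding infinitely_factorizable_def infinite_nat_iff_unbounded by blast
      \<comment> \<open>For \<open>k < n\<close> we have \<open>k mod n = k\<close>, so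
        \<open>w k = x k k = z k\<close>, which covers the prefix of length \<open>N\<close>. From
        \<open>n\<close> on the witnesses recur periodically and \<open>w\<close> may differ from
        \<open>z\<close>.\<close>
      define w where "w = (\<lambda>k. x (k mod n) k)"
      have "w \<in> interleaving_closure n X"
        using n(2) x(1) by (subst mem_interleaving_closure_iff) (auto simp: w_def intro!: exI[of _ x])
      then have "w \<in> X" using n by (auto simp: factorization_set_def)
      moreover have "\<forall>k<N. w k = z k" using n x by (simp add: w_def)
      ultimately show False using N sub by blast
    qed
  qed
qed

text \<open>The topology comes from two facts: a box in a product space carries the product of the
  subspace topologies, and subspaces of discrete spaces are discrete.\<close>

lemma is_product_of_alphabets_iff:
  assumes "X \<subseteq> topspace (full_shift A)" and "X \<noteq> {}"
  shows "is_product_of_alphabets A X \<longleftrightarrow> (\<exists>B. X = Pi\<^sub>E UNIV B)"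
proof
  assume "\<exists>B. X = Pi\<^sub>E UNIV B"
  then obtain B where X: "X = Pi\<^sub>E UNIV B" by blast
  \<comment> \<open>A nonempty box has nonempty factors, and its inclusion in the box with all
    factors \<open>A\<close> passes to each factor.\<close>
  have B: "B k \<noteq> {} \<and> B k \<subseteq> A" for k
    using assms unfolding X topspace_full_shift by (auto simp: subset_PiE PiE_eq_empty_iff)
  then have "subtopology (full_shift A) X = product_topology (\<lambda>k. discrete_topology (B k)) UNIV"
    unfolding full_shift_def X subtopology_product_topology subtopology_discrete_topology
    by (simp add: Int_absorb1)
  with B X show "is_product_of_alphabets A X"
    unfolding is_product_of_alphabets_def by blast
qed (auto simp: is_product_of_alphabets_def)

theorem theorem2p13:
  fixes A :: "'a set" and X :: "(nat \<Rightarrow> 'a) set"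
  assumes "finite A"
    and "closedin (full_shift A) X"
  shows "(infinitely_factorizable X \<longleftrightarrow> (\<forall>n\<ge>1. has_interleaving_factorization A n X)) \<and>
         ((\<forall>n\<ge>1. has_interleaving_factorization A n X) \<longleftrightarrow> factorization_set X = {n. n \<ge> 1}) \<and>
         (X \<noteq> {} \<longrightarrow>
           ((\<forall>n\<ge>1. has_interleaving_factorization A n X) \<longleftrightarrow> is_product_of_alphabets A X))"
proof -
  have sub: "X \<subseteq> topspace (full_shift A)" by (rule closedin_subset[OF assms(2)])
  have all: "(\<forall>n\<ge>1. has_interleaving_factorization A n X) \<longleftrightarrow> factorization_set X = {n. n \<ge> 1}"
    using has_interleaving_factorization_iff[OF _ sub] by (auto simp: factorization_set_def)
  have inf: "infinitely_factorizable X" if "factorization_set X = {n. n \<ge> 1}"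
    using that infinite_Ici[of "1::nat"] by (simp add: infinitely_factorizable_def atLeast_def)
  have prod: "\<exists>B. X = Pi\<^sub>E UNIV B" if "infinitely_factorizable X"
    by (rule exI, rule infinitely_factorizable_imp_product[OF assms(2) that])
  have full: "factorization_set X = {n. n \<ge> 1}" if B: "\<exists>B. X = Pi\<^sub>E UNIV B"
  proof -
    obtain B where X: "X = Pi\<^sub>E UNIV B" using B ..
    have "{n. n \<ge> 1} \<subseteq> factorization_set X"
      by (rule subsetI) (simp only: X mem_Collect_eq PiE_factorization_set)
    moreover have "factorization_set X \<subseteq> {n. n \<ge> 1}"
      unfolding factorization_set_def by blast
    ultimately show ?thesis by (rule equalityI[rotated])
  qed
  \<comment> \<open>The cycle \<open>prod\<close>, \<open>full\<close>, \<open>inf\<close> passes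
    through a bare product and also covers \<open>X = {}\<close>; nonemptiness enters only
    afterwards, when the factors must be nonempty.\<close>
  have "infinitely_factorizable X \<longleftrightarrow> factorization_set X = {n. n \<ge> 1}"
    by (rule iffI[OF full[OF prod] inf])
  moreover have "factorization_set X = {n. n \<ge> 1} \<longleftrightarrow> is_product_of_alphabets A X" if "X \<noteq> {}"
    unfolding is_product_of_alphabets_iff[OF sub that] by (rule iffI[OF prod[OF inf] full])
  ultimately show ?thesis unfolding all by (intro conjI impI refl)
qed

end
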